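(* Let $\pi\in S_n$ have label $(k,m_\ell)$, and let $T$ be the skeleton of $T(\pi)$. Then the root of $T$ has label $(k,m_\ell)$ and its children are exactly those with the following labels (counted with multiplicity): (1) for every $h=0,\dots,m_\ell-2$ and every $i=1,\dots,k-1-h$, there are $\binom{k-2-h}{i-1}$ children with label $(k-i,h)$; (2) if $\pi\neq id_n$ and $m_\ell\ge 1$, there are in addition, for every $i=0,\dots,k-m_\ell$, $\binom{k-m_\ell}{i}$ children with label $(k-i,m_\ell-1)$. In particular, if $m_\ell=0$ the root has no children.
   Context: $S_n$ is the set of permutations $\pi=\pi_1\dots\pi_n$ of $\{1,\dots,n\}$ and $id_n=12\dots n$. An element $\pi_j$ is a left-to-right maximum of $\pi$ if $\pi_j>\pi_i$ for all $i<j$. The bubblesort operator $\mathbf{B}$ is one pass of the bubblesort algorithm: scan the positions from left to right, each time exchanging the current element with the one to its right whenever the latter is smaller. Equivalently, writing $\pi=\mu_1A_1\mu_2A_2\dots\mu_kA_k$ where the $\mu_i$ are all the left-to-right maxima of $\pi$ (and the $A_i$ are possibly empty sequences), $\mathbf{B}(\pi)=A_1\mu_1A_2\mu_2\dots A_k\mu_k$. $T_n$ is the rooted tree whose nodes are the permutations in $S_n$, with root $id_n$, in which $\tau$ is a child of $\sigma$ if and only if $\mathbf{B}(\tau)=\sigma$ and $\sigma\ne\tau$. For $\pi\in S_n$, $T(\pi)$ is the subtree of $T_n$ rooted at $\pi$ (consisting of $\pi$ and all its descendants). The label of a permutation $\pi$ is the pair $(k,m_\ell)$ where $k$ is the number of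 left-to-right maxima of $\pi$ and $m_\ell\ge 0$ is the length of the longest suffix of $\pi$ all of whose elements are left-to-right maxima of $\pi$ (the symbol $m_\ell$ is just a name for this integer). The skeleton of $T(\pi)$ is obtained from $T(\pi)$ by replacing each permutation at a node with its label. *)

theory Defs
  imports
    "HOL-Combinatorics.Multiset_Permutations"
    "HOL-Library.Sublist"
begin

text \<open>
  A permutation \<open>\<pi> \<in> S\<^sub>n\<close> is its one-line notation, an element of
  \<^term>\<open>permutations_of_set {1..n}\<close>.
\<close>

abbreviation perms :: "nat \<Rightarrow> nat list set"
  where "perms n \<equiv> permutations_of_set {1..n}"

definition id_perm :: "nat \<Rightarrow> nat list"
  where "id_perm n = [1..<Suc n]"

fun bubble :: "nat list \<Rightarrow> nat list"
  where
    "bubble [] = []"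
  | "bubble [x] = [x]"
  | "bubble (x # y # xs) = (if y < x then y # bubble (x # xs) else x # bubble (y # xs))"

definition ltr_maxima :: "nat list \<Rightarrow> nat set"
  where "ltr_maxima \<pi> = {\<pi> ! j | j. j < length \<pi> \<and> (\<forall>i<j. \<pi> ! i < \<pi> ! j)}"

definition label :: "nat list \<Rightarrow> nat \<times> nat"
  where "label \<pi> =
    (card (ltr_maxima \<pi>), Max {length s | s. suffix s \<pi> \<and> set s \<subseteq> ltr_maxima \<pi>})"

text \<open>
  Rooted trees without an order on the children of a node; equal subtrees are counted with
  multiplicity.
\<close>

datatype 'a rtree = Node (root_of: 'a) (branches: "'a rtree multiset")

definition child_labels :: "'a rtree \<Rightarrow> 'a multiset"
  where "child_labels t = image_mset root_of (branches t)"

definition children :: "nat \<Rightarrow> nat list \<Rightarrow> nat list set"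
  where "children n \<sigma> = {\<tau> \<in> perms n. bubble \<tau> = \<sigma> \<and> \<sigma> \<noteq> \<tau>}"

lemma finite_children [simp]: "finite (children n \<sigma>)"
  by (simp add: children_def)

lemma mset_bubble [simp]: "mset (bubble xs) = mset xs"
  by (induction xs rule: bubble.induct) auto

lemma bubble_in_perms: "\<pi> \<in> perms n \<Longrightarrow> bubble \<pi> \<in> perms n"
  using mset_eq_setD[OF mset_bubble[of \<pi>]] mset_eq_imp_distinct_iff[OF mset_bubble[of \<pi>]]
  by (simp add: permutations_of_set_def)

lemma length_bubble [simp]: "length (bubble xs) = length xs"
  using mset_eq_length[OF mset_bubble] .

lemma bubble_lex: "bubble xs \<noteq> xs \<Longrightarrow> (bubble xs, xs) \<in> lex less_than"
  by (induction xs rule: bubble.induct) (simp_all split: if_splits)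

lemma wf_children: "wf {(\<tau>, \<sigma>). \<tau> \<in> children n \<sigma>}" (is "wf ?R")
proof -
  have "?R \<subseteq> (\<lambda>\<tau>. (\<tau>, bubble \<tau>)) ` perms n"
    unfolding children_def by blast
  then have "finite ?R"
    by (rule finite_subset) (rule finite_imageI[OF finite_permutations_of_set])
  have lex: "(\<sigma>, \<tau>) \<in> lex less_than" if "\<tau> \<in> children n \<sigma>" for \<sigma> \<tau>
    using that bubble_lex[of \<tau>] unfolding children_def by blast
  have "?R \<subseteq> (lex less_than)\<inverse>"
    using lex by blast
  moreover have "acyclic ((lex less_than)\<inverse> :: (nat list \<times> nat list) set)"
    unfolding acyclic_converse by (rule wf_acyclic[OF wf_lex[OF wf_less_than]])
  ultimately have "acyclic ?R"
    by (meson acyclic_subset)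
  with \<open>finite ?R\<close> show ?thesis
    by (rule finite_acyclic_wf)
qed

text \<open>
  \<open>T(\<pi>)\<close>: the node \<open>\<pi>\<close> with all its descendants under the child relation of \<open>T\<^sub>n\<close>.
  The lemmas \<open>set_bubblesort_tree\<close> and \<open>subtree_rooted_at\<close> below confirm that the nodes of
  \<open>T\<^sub>n\<close> are the elements of \<open>S\<^sub>n\<close> and that \<open>T(\<pi>)\<close> is the subtree of \<open>T\<^sub>n\<close> rooted at \<open>\<pi>\<close>.
\<close>

function perm_subtree :: "nat \<Rightarrow> nat list \<Rightarrow> nat list rtree"
  where "perm_subtree n \<pi> = Node \<pi> (image_mset (perm_subtree n) (mset_set (children n \<pi>)))"
  by pat_completeness auto
termination
proof (relation "same_fst (\<lambda>_. True) (\<lambda>n. {(\<tau>, \<sigma>). \<tau> \<in> children n \<sigma>})")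
  show "wf (same_fst (\<lambda>_. True) (\<lambda>n. {(\<tau>, \<sigma>). \<tau> \<in> children n \<sigma>}))"
    by (intro wf_same_fst wf_children)
qed (simp add: same_fst_def)

declare perm_subtree.simps [simp del]

definition bubblesort_tree :: "nat \<Rightarrow> nat list rtree"
  where "bubblesort_tree n = perm_subtree n (id_perm n)"

definition skeleton :: "nat \<Rightarrow> nat list \<Rightarrow> (nat \<times> nat) rtree"
  where "skeleton n \<pi> = map_rtree label (perm_subtree n \<pi>)"

lemma root_perm_subtree [simp]: "root_of (perm_subtree n \<pi>) = \<pi>"
  by (subst perm_subtree.simps) simp

lemma set_perm_subtree:
  "set_rtree (perm_subtree n \<pi>) = insert \<pi> (\<Union>\<tau>\<in>children n \<pi>. set_rtree (perm_subtree n \<tau>))"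
  by (subst perm_subtree.simps) simp

lemma id_perm_in_perms: "id_perm n \<in> perms n"
  by (auto simp: id_perm_def permutations_of_set_def)

lemma bubble_fixed_sorted: "bubble xs = xs \<Longrightarrow> sorted xs"
  by (induction xs rule: bubble.induct) (auto split: if_splits)

lemma bubble_fixed_id:
  assumes "\<pi> \<in> perms n" "bubble \<pi> = \<pi>"
  shows "\<pi> = id_perm n"
proof (rule sorted_distinct_set_unique)
  show "sorted \<pi>"
    using assms(2) by (rule bubble_fixed_sorted)
  show "sorted (id_perm n)" "distinct (id_perm n)"
    unfolding id_perm_def by (simp_all del: upt_Suc)
  show "distinct \<pi>" "set \<pi> = set (id_perm n)"
    using assms(1) id_perm_in_perms[of n] by (auto simp: permutations_of_set_def)
qed

lemma perm_subtree_subset_perms: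
  assumes "\<sigma> \<in> perms n"
  shows "set_rtree (perm_subtree n \<sigma>) \<subseteq> perms n"
  using wf_children[of n] assms
proof (induction \<sigma> rule: wf_induct_rule)
  case (less \<sigma>)
  then show ?case
    by (subst set_perm_subtree) (auto simp: children_def)
qed

lemma set_perm_subtree_child:
  "\<sigma> \<in> set_rtree (perm_subtree n \<rho>) \<Longrightarrow> \<tau> \<in> children n \<sigma> \<Longrightarrow> \<tau> \<in> set_rtree (perm_subtree n \<rho>)"
proof (induction \<rho> rule: wf_induct_rule[OF wf_children[of n]])
  case (1 \<rho>)
  show ?case
  proof (cases "\<sigma> = \<rho>")
    case True
    then show ?thesis
      using 1(3) set_perm_subtree[of n \<rho>] set_perm_subtree[of n \<tau>] by auto
  next
    case False
    then show ?thesis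
      using 1 set_perm_subtree[of n \<rho>] by auto
  qed
qed

lemma set_bubblesort_tree: "set_rtree (bubblesort_tree n) = perms n"
proof
  show "set_rtree (bubblesort_tree n) \<subseteq> perms n"
    unfolding bubblesort_tree_def by (rule perm_subtree_subset_perms[OF id_perm_in_perms])
  have "\<pi> \<in> perms n \<Longrightarrow> \<pi> \<in> set_rtree (perm_subtree n (id_perm n))" for \<pi>
  proof (induction \<pi> rule: wf_induct_rule[OF wf_lex[OF wf_less_than]])
    case (1 \<pi>)
    show ?case
    proof (cases "bubble \<pi> = \<pi>")
      case True
      then show ?thesis
        using bubble_fixed_id[OF 1(2)] set_perm_subtree by blast
    next
      case False
      then have "bubble \<pi> \<in> set_rtree (perm_subtree n (id_perm n))"
        using 1 bubble_lex bubble_in_perms by blast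
      then show ?thesis
        by (rule set_perm_subtree_child) (use False 1(2) in \<open>auto simp: children_def\<close>)
    qed
  qed
  then show "perms n \<subseteq> set_rtree (bubblesort_tree n)"
    unfolding bubblesort_tree_def by blast
qed

inductive_set subtrees :: "'a rtree \<Rightarrow> 'a rtree set" for t
  where
    self: "t \<in> subtrees t"
  | branch: "s \<in> subtrees t \<Longrightarrow> s' \<in># branches s \<Longrightarrow> s' \<in> subtrees t"

lemma subtrees_perm_subtree:
  "s \<in> subtrees (perm_subtree n \<rho>) \<Longrightarrow> s = perm_subtree n (root_of s)"
proof (induction rule: subtrees.induct)
  case (branch s s')
  have "branches s = image_mset (perm_subtree n) (mset_set (children n (root_of s)))"
    by (subst branch.IH, subst perm_subtree.simps) simp
  then obtain \<tau> where "s' = perm_subtree n \<tau>"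
    using branch.hyps(2) by auto
  then show ?case
    by simp
qed simp

lemma root_of_subtree: "a \<in> set_rtree t \<Longrightarrow> t \<in> subtrees u \<Longrightarrow> \<exists>s\<in>subtrees u. root_of s = a"
proof (induction t)
  case (Node x ts)
  show ?case
  proof (cases "a = x")
    case True
    then show ?thesis
      using Node(3) by force
  next
    case False
    then obtain t where "t \<in># ts" "a \<in> set_rtree t"
      using Node(2) by auto
    then show ?thesis
      using Node(1,3) subtrees.branch[of "Node x ts" u t] by auto
  qed
qed

lemma subtree_rooted_at:
  assumes "\<pi> \<in> perms n"
  shows "{s \<in> subtrees (bubblesort_tree n). root_of s = \<pi>} = {perm_subtree n \<pi>}"
proof -
  have eq: "s = perm_subtree n \<pi>" if "s \<in> subtrees (bubblesort_tree n)" "root_of s = \<pi>" for s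
    using subtrees_perm_subtree[OF that(1)[unfolded bubblesort_tree_def]]
    unfolding that(2) .
  have "\<pi> \<in> set_rtree (bubblesort_tree n)"
    using assms by (simp add: set_bubblesort_tree)
  from root_of_subtree[OF this subtrees.self]
  obtain s where s: "s \<in> subtrees (bubblesort_tree n)" "root_of s = \<pi>"
    by (elim bexE)
  have mem: "perm_subtree n \<pi> \<in> subtrees (bubblesort_tree n)"
    using s(1) unfolding eq[OF s] .
  show ?thesis
  proof (intro equalityI subsetI)
    fix t
    assume "t \<in> {s \<in> subtrees (bubblesort_tree n). root_of s = \<pi>}"
    then have "t \<in> subtrees (bubblesort_tree n)" "root_of t = \<pi>"
      by simp_all
    then have "t = perm_subtree n \<pi>"
      by (rule eq)
    then show "t \<in> {perm_subtree n \<pi>}"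
      by (rule ssubst) (rule singletonI)
  next
    fix t
    assume "t \<in> {perm_subtree n \<pi>}"
    then have t: "t = perm_subtree n \<pi>"
      by (rule singletonD)
    show "t \<in> {s \<in> subtrees (bubblesort_tree n). root_of s = \<pi>}"
      unfolding t using mem root_perm_subtree by (intro CollectI conjI)
  qed
qed

end

theory Submission
  imports Defs
begin

text \<open>
  Bubblesort carries the running maximum, so \<open>B(t z)\<close> is \<open>B(t)\<close> with its last entry \<open>x\<close>
  replaced by \<open>min x z\<close>, \<open>max x z\<close>. Hence the preimages of \<open>\<rho> y x\<close>, where \<open>x\<close> is the
  maximum, are the words \<open>t x\<close> with \<open>B(t) = \<rho> y\<close> and the words \<open>t y\<close> with
  \<open>B(t) = \<rho> x\<close>. Appending \<open>x\<close> increments both components of the label, while appending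
  \<open>y\<close> keeps the first and resets the second to \<open>0\<close>. This gives a recursion for the multiset
  of labels of the preimages, which the claimed formula satisfies by Pascal's rule.
\<close>

section \<open>One bubblesort pass on a word with an appended entry\<close>

lemma bubble_snoc:
  "xs \<noteq> [] \<Longrightarrow> bubble (xs @ [a]) =
    butlast (bubble xs) @ [min a (last (bubble xs)), max a (last (bubble xs))]"
proof (induction xs rule: bubble.induct)
  case (3 x y xs)
  have "bubble (z # xs) \<noteq> []" for z
    by (metis length_bubble length_0_conv list.distinct(1))
  with 3 show ?case by auto
qed auto

lemma set_bubble [simp]: "set (bubble xs) = set xs"
  by (rule mset_eq_setD) simp

lemma bubble_eq_Nil_iff [simp]: "bubble xs = [] \<longleftrightarrow> xs = []"
  by (metis length_bubble length_0_conv)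

lemma bubble_sorted: "sorted xs \<Longrightarrow> bubble xs = xs"
  by (induction xs rule: bubble.induct) auto

lemma le_last_bubble: "y \<in> set xs \<Longrightarrow> y \<le> last (bubble xs)"
proof (induction xs arbitrary: y rule: rev_induct)
  case (snoc a xs)
  then show ?case
    by (cases "xs = []") (auto simp: bubble_snoc le_max_iff_disj)
qed simp

section \<open>Left-to-right maxima and labels under appending\<close>

lemma ltr_maxima_snoc:
  "ltr_maxima (xs @ [x]) = ltr_maxima xs \<union> (if \<forall>y\<in>set xs. y < x then {x} else {})"
proof (intro set_eqI iffI)
  fix z
  assume "z \<in> ltr_maxima (xs @ [x])"
  then obtain j where j: "j < Suc (length xs)" "z = (xs @ [x]) ! j"
    "\<forall>i<j. (xs @ [x]) ! i < (xs @ [x]) ! j"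
    by (auto simp: ltr_maxima_def)
  show "z \<in> ltr_maxima xs \<union> (if \<forall>y\<in>set xs. y < x then {x} else {})"
  proof (cases "j < length xs")
    case True
    then have "\<forall>i<j. xs ! i < xs ! j"
      using j(3) by (metis nth_append order_less_trans)
    then show ?thesis
      using j(2) True by (auto simp: ltr_maxima_def nth_append)
  next
    case False
    then have "j = length xs"
      using j(1) by simp
    then have "z = x" "\<forall>y\<in>set xs. y < x"
      using j(2,3) by (auto simp: nth_append in_set_conv_nth)
    then show ?thesis
      by simp
  qed
next
  fix z
  assume z: "z \<in> ltr_maxima xs \<union> (if \<forall>y\<in>set xs. y < x then {x} else {})"
  show "z \<in> ltr_maxima (xs @ [x])"
  proof (cases "z \<in> ltr_maxima xs")
    case True
    then obtain j where "j < length xs" "z = xs ! j" "\<forall>i<j. xs ! i < xs ! j"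
      by (auto simp: ltr_maxima_def)
    then show ?thesis
      unfolding ltr_maxima_def by (auto simp: nth_append intro!: exI[of _ j])
  next
    case False
    then have "z = x" "\<forall>y\<in>set xs. y < x"
      using z by (auto split: if_splits)
    then show ?thesis
      unfolding ltr_maxima_def by (auto simp: nth_append intro!: exI[of _ "length xs"])
  qed
qed

lemma ltr_maxima_Nil [simp]: "ltr_maxima [] = {}"
  by (simp add: ltr_maxima_def)

lemma ltr_maxima_subset: "ltr_maxima xs \<subseteq> set xs"
  by (auto simp: ltr_maxima_def)

lemma finite_ltr_maxima [simp]: "finite (ltr_maxima xs)"
  using ltr_maxima_subset finite_subset by blast

lemma label_Nil [simp]: "label [] = (0, 0)"
  by (simp add: label_def)

lemma label_snoc_max:
  assumes "\<forall>y\<in>set xs. y < x"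
  shows "label (xs @ [x]) = map_prod Suc Suc (label xs)"
proof -
  have x: "x \<notin> set xs"
    using assms by blast
  define L where "L xs = {length s | s. suffix s xs \<and> set s \<subseteq> ltr_maxima xs}" for xs
  have ltr: "ltr_maxima (xs @ [x]) = insert x (ltr_maxima xs)"
    using assms by (simp add: ltr_maxima_snoc)
  have fin: "finite (L xs)"
    by (rule finite_subset[of _ "{..length xs}"]) (auto simp: L_def dest: suffix_length_le)
  have ne: "L xs \<noteq> {}"
    by (auto simp: L_def intro!: exI[of _ "[]"])
  have "set s \<subseteq> ltr_maxima (xs @ [x]) \<longleftrightarrow> set s \<subseteq> ltr_maxima xs" if "suffix s xs" for s
    using that x set_mono_suffix[OF that] by (auto simp: ltr)
  then have "{s. suffix s (xs @ [x]) \<and> set s \<subseteq> ltr_maxima (xs @ [x])} =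
      insert [] ((\<lambda>s. s @ [x]) ` {s. suffix s xs \<and> set s \<subseteq> ltr_maxima xs})"
    unfolding suffix_snoc by (auto simp: ltr)
  then have "L (xs @ [x]) = insert 0 (Suc ` L xs)"
    by (simp only: L_def setcompr_eq_image) (simp add: image_image)
  also have "Max \<dots> = Max (Suc ` L xs)"
    using fin ne by simp
  also have "\<dots> = Suc (Max (L xs))"
    using fin ne by (intro mono_Max_commute[symmetric] monoI) auto
  finally have "Max (L (xs @ [x])) = Suc (Max (L xs))" .
  moreover have "card (ltr_maxima (xs @ [x])) = Suc (card (ltr_maxima xs))"
    using x ltr_maxima_subset[of xs] by (subst ltr, subst card_insert_disjoint) auto
  ultimately show ?thesis
    by (simp add: label_def L_def)
qed

lemma label_snoc_not_max:
  assumes "x \<notin> set xs" "z \<in> set xs" "x < z"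
  shows "label (xs @ [x]) = (fst (label xs), 0)"
proof -
  have ltr: "ltr_maxima (xs @ [x]) = ltr_maxima xs"
    using assms by (auto simp: ltr_maxima_snoc)
  have "x \<notin> ltr_maxima xs"
    using assms(1) ltr_maxima_subset by blast
  then have "{length s | s. suffix s (xs @ [x]) \<and> set s \<subseteq> ltr_maxima xs} = {0}"
    by (auto simp: suffix_snoc)
  then show ?thesis
    by (simp add: label_def ltr)
qed

lemma label_sorted:
  "sorted xs \<Longrightarrow> distinct xs \<Longrightarrow> label xs = (length xs, length xs)"
proof (induction xs rule: rev_induct)
  case (snoc x xs)
  then have "\<forall>y\<in>set xs. y < x"
    by (auto simp: sorted_append order_less_le)
  with snoc show ?case
    by (simp add: label_snoc_max sorted_append)
qed simp

section \<open>Preimages under bubblesort\<close>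

text \<open>Unlike \<open>children\<close>, this imposes no ground set \<open>{1..n}\<close> and
  keeps fixed points. The recursion shortens words, so it leaves \<open>perms n\<close>, and the
  word itself must be counted until the very end.\<close>

definition preimages :: "nat list \<Rightarrow> nat list set"
  where "preimages xs = {t. bubble t = xs}"

lemma finite_preimages [simp]: "finite (preimages xs)"
  by (rule finite_subset[of _ "permutations_of_multiset (mset xs)"])
    (auto simp: preimages_def intro!: permutations_of_multisetI)

lemma preimages_set: "t \<in> preimages xs \<Longrightarrow> set t = set xs"
  by (auto simp: preimages_def)

lemma preimages_distinct: "t \<in> preimages xs \<Longrightarrow> distinct xs \<Longrightarrow> distinct t"
  using mset_eq_imp_distinct_iff[OF mset_bubble] by (auto simp: preimages_def)

text \<open>A pass always ends in the maximum of the word. This removes the first summand of the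
  recursion whenever \<open>y\<close> is not a left-to-right maximum.\<close>

lemma preimages_empty:
  assumes "z \<in> set xs" "y < z"
  shows "preimages (xs @ [y]) = {}"
proof -
  have False if t: "t \<in> preimages (xs @ [y])" for t
  proof -
    have "z \<le> last (bubble t)"
      using assms preimages_set[OF t] by (intro le_last_bubble) simp
    then show False
      using t assms by (simp add: preimages_def)
  qed
  then show ?thesis by blast
qed

lemma preimages_singleton: "preimages [x] = {[x]}"
proof -
  have "t = [x]" if "bubble t = [x]" for t
  proof -
    have "length t = 1"
      using arg_cong[OF that, of length] by simp
    then show ?thesis
      using that by (cases t) auto
  qed
  then show ?thesis
    by (auto simp: preimages_def)
qed

lemma preimages_snoc2:
  assumes "y < x"
  shows "preimages (r @ [y, x]) =
    (\<lambda>t. t @ [x]) ` preimages (r @ [y]) \<union> (\<lambda>t. t @ [y]) ` preimages (r @ [x])"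
proof (intro equalityI subsetI)
  fix s
  assume "s \<in> preimages (r @ [y, x])"
  then have s: "bubble s = r @ [y, x]"
    by (simp add: preimages_def)
  have "length s \<ge> 2"
    using arg_cong[OF s, of length] by simp
  then obtain t a where t: "s = t @ [a]" "t \<noteq> []"
    by (cases s rule: rev_cases) fastforce+
  \<comment> \<open>The value carried out of \<open>t\<close>; it is compared with the final entry
    \<open>a\<close>, and either of the two may be the larger one.\<close>
  define c where "c = last (bubble t)"
  have b: "bubble t = butlast (bubble t) @ [c]"
    using t(2) by (simp add: c_def)
  have "butlast (bubble t) @ [min a c, max a c] = r @ [y, x]"
    using s t by (simp add: bubble_snoc c_def)
  then have "butlast (bubble t) = r" "min a c = y" "max a c = x"
    by simp_all
  then have "bubble t = r @ [c]" "a = y \<and> c = x \<or> a = x \<and> c = y"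
    using b by (auto simp: min_def max_def split: if_splits)
  then show "s \<in> (\<lambda>t. t @ [x]) ` preimages (r @ [y]) \<union> (\<lambda>t. t @ [y]) ` preimages (r @ [x])"
    using t by (auto simp: preimages_def)
next
  fix s
  assume "s \<in> (\<lambda>t. t @ [x]) ` preimages (r @ [y]) \<union> (\<lambda>t. t @ [y]) ` preimages (r @ [x])"
  then consider t where "s = t @ [x]" "bubble t = r @ [y]" | t where "s = t @ [y]" "bubble t = r @ [x]"
    by (auto simp: preimages_def)
  then show "s \<in> preimages (r @ [y, x])"
  proof cases
    case 1
    then have "t \<noteq> []" by auto
    then show ?thesis using 1 assms by (simp add: preimages_def bubble_snoc)
  next
    case 2
    then have "t \<noteq> []" by auto
    then show ?thesis using 2 assms by (simp add: preimages_def bubble_snoc)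
  qed
qed

section \<open>The multiset of preimage labels: recursion and Pascal's rule\<close>

definition preimage_labels :: "nat list \<Rightarrow> (nat \<times> nat) multiset"
  where "preimage_labels xs = image_mset label (mset_set (preimages xs))"

lemma preimage_labels_snoc2:
  assumes "distinct r" "y \<notin> set r" "\<forall>z\<in>set r. z < x" "y < x"
  shows "preimage_labels (r @ [y, x]) =
    image_mset (map_prod Suc Suc) (preimage_labels (r @ [y])) +
    image_mset (\<lambda>l. (fst l, 0)) (preimage_labels (r @ [x]))"
proof -
  have *: "mset_set ((\<lambda>t. t @ [a]) ` preimages xs) = image_mset (\<lambda>t. t @ [a]) (mset_set (preimages xs))"
    for a xs
    by (rule image_mset_mset_set[symmetric]) (simp add: inj_on_def)
  have "mset_set (preimages (r @ [y, x])) =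
      image_mset (\<lambda>t. t @ [x]) (mset_set (preimages (r @ [y]))) +
      image_mset (\<lambda>t. t @ [y]) (mset_set (preimages (r @ [x])))"
    unfolding preimages_snoc2[OF assms(4)] *[symmetric]
    \<comment> \<open>The two families are disjoint, as their words end in different
      letters.\<close>
    using assms(4) by (intro mset_set_Union) auto
  moreover have "label (t @ [x]) = map_prod Suc Suc (label t)" if "t \<in> preimages (r @ [y])" for t
    using preimages_set[OF that] assms by (intro label_snoc_max) auto
  moreover have "label (t @ [y]) = (fst (label t), 0)" if "t \<in> preimages (r @ [x])" for t
    using preimages_set[OF that] assms by (intro label_snoc_not_max[of _ _ x]) auto
  ultimately show ?thesis
    by (auto simp: preimage_labels_def multiset.map_comp intro!: arg_cong2[of _ _ _ _ "(+)"] image_mset_cong)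
qed

lemma preimage_labels_not_max:
  assumes "z \<in> set xs" "y < z"
  shows "preimage_labels (xs @ [y]) = {#}"
  using preimages_empty[OF assms] by (simp add: preimage_labels_def)

lemma image_mset_sum:
  "image_mset f (\<Sum>i\<in>A. g i) = (\<Sum>i\<in>A. image_mset f (g i))"
  by (induction A rule: infinite_finite_induct) auto

lemma replicate_mset_add: "replicate_mset (a + b) x = replicate_mset a x + replicate_mset b x"
  by (induction a) auto

lemma sum_replicate_choose_Suc:
  "(\<Sum>i\<le>Suc j. replicate_mset (Suc j choose i) (f i)) =
    (\<Sum>i\<le>j. replicate_mset (j choose i) (f i)) +
    (\<Sum>i\<le>j. replicate_mset (j choose i) (f (Suc i)))"
proof -
  have "(\<Sum>i\<le>Suc j. replicate_mset (Suc j choose i) (f i)) =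
      {#f 0#} + (\<Sum>i\<le>j. replicate_mset (j choose Suc i) (f (Suc i))) +
      (\<Sum>i\<le>j. replicate_mset (j choose i) (f (Suc i)))"
    by (subst sum.atMost_Suc_shift)
      (simp add: replicate_mset_add sum.distrib add_ac del: sum.atMost_Suc)
  also have "{#f 0#} + (\<Sum>i\<le>j. replicate_mset (j choose Suc i) (f (Suc i))) =
      (\<Sum>i\<le>Suc j. replicate_mset (j choose i) (f i))"
    by (subst sum.atMost_Suc_shift) simp
  \<comment> \<open>The top term has coefficient \<open>j choose Suc j\<close>, which is
    zero.\<close>
  also have "\<dots> = (\<Sum>i\<le>j. replicate_mset (j choose i) (f i))"
    by (simp add: binomial_eq_0)
  finally show ?thesis .
qed

text \<open>Appending \<open>y\<close> to a preimage of \<open>r @ [x]\<close> resets the second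
  component, so from that family only the first components survive. If \<open>y\<close> exceeds all
  of \<open>r\<close>, both families contribute and Pascal's rule combines them. Otherwise the first
  family is empty and the number of left-to-right maxima of \<open>r\<close> does not
  change.\<close>

lemma fst_preimage_labels:
  assumes "distinct r" "\<forall>z\<in>set r. z < x"
  shows "image_mset fst (preimage_labels (r @ [x])) =
    (\<Sum>i\<le>fst (label r). replicate_mset (fst (label r) choose i) (Suc (fst (label r)) - i))"
  using assms
proof (induction r arbitrary: x rule: rev_induct)
  case Nil
  have "label [x] = (1, 1)"
    using label_snoc_max[of "[]" x] by simp
  then show ?case
    by (simp add: preimage_labels_def preimages_singleton)
next
  case (snoc y r)
  let ?j = "fst (label r)"
  let ?K = "\<Sum>i\<le>?j. replicate_mset (?j choose i) (Suc ?j - i)"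
  have rec: "image_mset fst (preimage_labels ((r @ [y]) @ [x])) =
      image_mset Suc (image_mset fst (preimage_labels (r @ [y]))) +
      image_mset fst (preimage_labels (r @ [x]))"
    using snoc.prems preimage_labels_snoc2[of r y x]
    by (simp add: multiset.map_comp o_def)
  \<comment> \<open>The induction hypothesis is needed for two last letters, here \<open>x\<close>
    and below also \<open>y\<close>; hence \<open>x\<close> is arbitrary.\<close>
  have IHx: "image_mset fst (preimage_labels (r @ [x])) = ?K"
    using snoc by simp
  show ?case
  proof (cases "\<forall>z\<in>set r. z < y")
    case True
    have "image_mset fst (preimage_labels (r @ [y])) = ?K"
      using snoc True by simp
    moreover have "image_mset Suc ?K =
        (\<Sum>i\<le>?j. replicate_mset (?j choose i) (Suc (Suc ?j) - i))"
      unfolding image_mset_sum by (intro sum.cong) (auto simp: Suc_diff_le)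
    ultimately show ?thesis
      using True unfolding rec IHx by (simp only: label_snoc_max fst_map_prod sum_replicate_choose_Suc) simp
  next
    case False
    then obtain z where "z \<in> set r" "y < z"
      using snoc.prems(1) by (metis distinct_append disjoint_insert(1) list.simps(15) not_less_iff_gr_or_eq)
    then show ?thesis
      using snoc.prems(1) unfolding rec IHx
      by (simp add: preimage_labels_not_max label_snoc_not_max[of y r z])
  qed
qed

section \<open>Closed form for the preimage labels\<close>

text \<open>Family (1) of the claim. The bound \<open>h + 2 \<le> m\<close> avoids truncated
  subtraction, so that the family is empty for \<open>m \<le> 1\<close>.\<close>

definition gap_labels :: "nat \<Rightarrow> nat \<Rightarrow> (nat \<times> nat) multiset"
  where "gap_labels k m = (\<Sum>h\<in>{h. h + 2 \<le> m}. \<Sum>i\<in>{1..k - 1 - h}.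
    replicate_mset ((k - 2 - h) choose (i - 1)) (k - i, h))"

lemma gap_labels_le_1: "m \<le> 1 \<Longrightarrow> gap_labels k m = {#}"
  by (auto simp: gap_labels_def intro!: sum.neutral)

text \<open>The layer \<open>h = 0\<close> is exactly what the words ending in \<open>y\<close>
  contribute, after shifting \<open>i\<close> by one. The layers with positive \<open>h\<close> are
  those of the shorter word with both label components incremented.\<close>

lemma gap_labels_Suc:
  assumes "m \<ge> 1"
  shows "gap_labels (Suc (Suc j)) (Suc m) = image_mset (map_prod Suc Suc) (gap_labels (Suc j) m) +
    (\<Sum>i\<le>j. replicate_mset (j choose i) (Suc j - i, 0))"
proof -
  let ?g = "\<lambda>h. \<Sum>i\<in>{1..Suc j - h}. replicate_mset ((j - h) choose (i - 1)) (Suc (Suc j) - i, h)"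
  have fin: "finite {h. h + 2 \<le> m}"
    by (rule finite_subset[of _ "{..m}"]) auto
  have "{h. h + 2 \<le> Suc m} = insert 0 (Suc ` {h. h + 2 \<le> m})"
    using assms by (auto simp: image_iff elim: not0_implies_Suc[elim_format])
  then have "gap_labels (Suc (Suc j)) (Suc m) = ?g 0 + (\<Sum>h\<in>{h. h + 2 \<le> m}. ?g (Suc h))"
    using fin by (simp add: gap_labels_def sum.reindex)
  also have "?g 0 = (\<Sum>i\<le>j. replicate_mset (j choose i) (Suc j - i, 0))"
    by (rule sum.reindex_bij_witness[of _ Suc "\<lambda>i. i - 1"]) auto
  also have "(\<Sum>h\<in>{h. h + 2 \<le> m}. ?g (Suc h)) = image_mset (map_prod Suc Suc) (gap_labels (Suc j) m)"
    unfolding gap_labels_def image_mset_sum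
    by (intro sum.cong refl) (auto simp: Suc_diff_le)
  finally show ?thesis
    by (simp add: add.commute)
qed

text \<open>The conditional covers fixed points: for a sorted word \<open>k = m\<close>, so the last
  sum is the single label \<open>(k, m)\<close> of the word itself. In the induction, a new maximum
  \<open>y\<close> shifts the old formula and adds a layer \<open>h = 0\<close>; any other
  \<open>y\<close> restarts the formula at \<open>m = 1\<close>.\<close>

lemma preimage_labels_eq:
  assumes "distinct r" "\<forall>z\<in>set r. z < x" "label (r @ [x]) = (k, m)"
  shows "preimage_labels (r @ [x]) = gap_labels k m +
    (\<Sum>i\<le>k - m. replicate_mset ((k - m) choose i)
      (k - i, if sorted (r @ [x]) then m else m - 1))"
  using assms
proof (induction r arbitrary: x k m rule: rev_induct)
  case Nil
  have "label [x] = (1, 1)"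
    using label_snoc_max[of "[]" x] by simp
  moreover from this have "k = 1" "m = 1"
    using Nil by auto
  ultimately show ?case
    by (simp add: preimage_labels_def preimages_singleton gap_labels_le_1)
next
  case (snoc y r)
  define j where "j = fst (label r)"
  have km: "(k, m) = map_prod Suc Suc (label (r @ [y]))"
    using snoc.prems label_snoc_max by metis
  have "image_mset (\<lambda>l. (fst l, 0)) (preimage_labels (r @ [x])) =
      image_mset (\<lambda>a. (a, 0)) (image_mset fst (preimage_labels (r @ [x])))"
    by (simp add: multiset.map_comp o_def)
  also have "image_mset fst (preimage_labels (r @ [x])) =
      (\<Sum>i\<le>j. replicate_mset (j choose i) (Suc j - i))"
    using snoc.prems unfolding j_def by (intro fst_preimage_labels) auto
  finally have rec: "preimage_labels ((r @ [y]) @ [x]) =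
      image_mset (map_prod Suc Suc) (preimage_labels (r @ [y])) +
      (\<Sum>i\<le>j. replicate_mset (j choose i) (Suc j - i, 0))"
    using snoc.prems preimage_labels_snoc2[of r y x] by (simp add: image_mset_sum)
  show ?case
  proof (cases "\<forall>z\<in>set r. z < y")
    case True
    obtain m' where lab: "label (r @ [y]) = (Suc j, Suc m')"
      using label_snoc_max[OF True] by (cases "label r") (simp add: j_def)
    have k: "k = Suc (Suc j)" "m = Suc (Suc m')"
      using km lab by auto
    have "sorted ((r @ [y]) @ [x]) \<longleftrightarrow> sorted (r @ [y])"
      using snoc.prems(2) by (auto simp: sorted_append)
    moreover have "preimage_labels (r @ [y]) = gap_labels (Suc j) (Suc m') +
        (\<Sum>i\<le>Suc j - Suc m'. replicate_mset ((Suc j - Suc m') choose i)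
          (Suc j - i, if sorted (r @ [y]) then Suc m' else Suc m' - 1))"
      using snoc.prems True lab by (intro snoc.IH) auto
    \<comment> \<open>Stated for every \<open>c\<close>, since the conditional can take either of
      two values.\<close>
    moreover have "image_mset (map_prod Suc Suc)
          (\<Sum>i\<le>j - m'. replicate_mset ((j - m') choose i) (Suc j - i, c)) =
        (\<Sum>i\<le>j - m'. replicate_mset ((j - m') choose i) (Suc (Suc j) - i, Suc c))" for c
      unfolding image_mset_sum by (intro sum.cong) (auto simp: Suc_diff_le)
    ultimately show ?thesis
      unfolding rec k by (simp add: gap_labels_Suc add_ac)
  next
    case False
    then obtain z where z: "z \<in> set r" "y < z"
      using snoc.prems(1) by (metis distinct_append disjoint_insert(1) list.simps(15) not_less_iff_gr_or_eq)
    then have "label (r @ [y]) = (j, 0)"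
      using snoc.prems(1) label_snoc_not_max[of y r z] by (simp add: j_def)
    \<comment> \<open>Now \<open>k - m = j\<close> and \<open>m - 1 = 0\<close>, so the words ending
      in \<open>y\<close> give precisely the last sum, and \<open>gap_labels\<close>
      vanishes.\<close>
    then have "k = Suc j" "m = 1"
      using km by auto
    moreover have "\<not> sorted ((r @ [y]) @ [x])"
      using z by (fastforce simp: sorted_append)
    ultimately show ?thesis
      unfolding rec using z by (simp add: preimage_labels_not_max gap_labels_le_1)
  qed
qed

section \<open>From preimages to children and skeletons\<close>

lemma children_eq_preimages:
  assumes "\<pi> \<in> perms n"
  shows "children n \<pi> = preimages \<pi> - {\<pi>}"
proof -
  have "t \<in> perms n" if "t \<in> preimages \<pi>" for t
    using assms preimages_set[OF that] preimages_distinct[OF that]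
    by (simp add: permutations_of_set_def)
  then show ?thesis
    by (auto simp: children_def preimages_def)
qed

lemma sorted_perms_iff:
  assumes "\<pi> \<in> perms n"
  shows "sorted \<pi> \<longleftrightarrow> \<pi> = id_perm n"
proof
  assume "sorted \<pi>"
  then show "\<pi> = id_perm n"
    using bubble_fixed_id[OF assms] bubble_sorted by blast
next
  assume "\<pi> = id_perm n"
  then show "sorted \<pi>"
    by (simp add: id_perm_def del: upt_Suc)
qed

lemma image_label_children:
  assumes "\<pi> \<in> perms n" "label \<pi> = (k, m)" "m \<ge> 1"
  shows "image_mset label (mset_set (children n \<pi>)) = gap_labels k m +
    (if \<pi> \<noteq> id_perm n
     then \<Sum>i\<le>k - m. replicate_mset ((k - m) choose i) (k - i, m - 1) else {#})"
proof -
  have dist: "distinct \<pi>"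
    using assms(1) by (simp add: permutations_of_set_def)
  have "\<pi> \<noteq> []"
    using assms(2,3) by auto
  then obtain r x where \<pi>: "\<pi> = r @ [x]"
    by (metis append_butlast_last_id)
  \<comment> \<open>A last entry that is not a left-to-right maximum would force
    \<open>m = 0\<close>.\<close>
  have max: "\<forall>z\<in>set r. z < x"
  proof (intro ballI, rule ccontr)
    fix z
    assume z: "z \<in> set r" "\<not> z < x"
    have x: "x \<notin> set r"
      using dist unfolding \<pi> by simp
    moreover have "x < z"
      using x z by (metis linorder_less_linear)
    ultimately have "label \<pi> = (fst (label r), 0)"
      unfolding \<pi> using z(1) by (intro label_snoc_not_max)
    then show False
      using assms(2,3) by simp
  qed
  have eq: "preimage_labels \<pi> = gap_labels k m +
      (\<Sum>i\<le>k - m. replicate_mset ((k - m) choose i) (k - i, if sorted \<pi> then m else m - 1))"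
    using preimage_labels_eq[OF _ max] assms(2) dist \<pi> by simp
  show ?thesis
  proof (cases "\<pi> = id_perm n")
    case True
    then have s: "sorted \<pi>"
      using sorted_perms_iff assms(1) by blast
    \<comment> \<open>The last sum of \<open>eq\<close> collapses to the label of
      \<open>\<pi>\<close>, which is cancelled because the fixed point \<open>\<pi>\<close> is not
      its own child.\<close>
    then have "k = m"
      using label_sorted[OF s dist] assms(2) by simp
    moreover have "\<pi> \<in> preimages \<pi>"
      using bubble_sorted[OF s] by (simp add: preimages_def)
    then have "preimage_labels \<pi> = add_mset (label \<pi>) (image_mset label (mset_set (children n \<pi>)))"
      by (simp add: preimage_labels_def children_eq_preimages[OF assms(1)]
        mset_set.remove[of "preimages \<pi>" \<pi>])
    ultimately show ?thesis
      using eq s True assms(2) by simp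
  next
    case False
    then have "\<pi> \<notin> preimages \<pi>"
      using bubble_fixed_id[OF assms(1)] unfolding preimages_def by blast
    then have "image_mset label (mset_set (children n \<pi>)) = preimage_labels \<pi>"
      by (simp add: preimage_labels_def children_eq_preimages[OF assms(1)])
    then show ?thesis
      using eq False sorted_perms_iff[OF assms(1)] by simp
  qed
qed

text \<open>If \<open>m = 0\<close>, the last entry is smaller than some earlier one, whereas every
  pass ends in the maximum.\<close>

lemma children_empty:
  assumes "\<pi> \<in> perms n" "label \<pi> = (k, 0)"
  shows "children n \<pi> = {}"
proof (cases \<pi> rule: rev_cases)
  case Nil
  then show ?thesis
    by (auto simp: children_def)
next
  case (snoc r x)
  have "\<not> (\<forall>z\<in>set r. z < x)"
    using label_snoc_max[of r x] assms(2) snoc by (cases "label r") auto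
  then obtain z where "z \<in> set r" "x < z"
    using permutations_of_setD(2)[OF assms(1)] snoc by (auto simp: not_less order_le_less)
  then show ?thesis
    using preimages_empty children_eq_preimages[OF assms(1)] snoc by auto
qed

lemma skeleton_unfold:
  "skeleton n \<pi> = Node (label \<pi>) (image_mset (skeleton n) (mset_set (children n \<pi>)))"
  unfolding skeleton_def
  by (subst perm_subtree.simps) (simp add: multiset.map_comp o_def)

lemma root_skeleton: "root_of (skeleton n \<pi>) = label \<pi>"
  by (subst skeleton_unfold) simp

lemma branches_skeleton:
  "branches (skeleton n \<pi>) = image_mset (skeleton n) (mset_set (children n \<pi>))"
  by (subst skeleton_unfold) simp

lemma child_labels_skeleton:
  "child_labels (skeleton n \<pi>) = image_mset label (mset_set (children n \<pi>))"
  by (simp add: child_labels_def branches_skeleton multiset.map_comp o_def root_skeleton)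

theorem proposition3p7:
  fixes n k m :: nat and \<pi> :: "nat list" and T :: "(nat \<times> nat) rtree"
  assumes "\<pi> \<in> perms n"
    and "label \<pi> = (k, m)"
    and "T = skeleton n \<pi>"
  shows "root_of T = (k, m) \<and>
    child_labels T =
      (\<Sum>h\<in>{h. h + 2 \<le> m}. \<Sum>i\<in>{1..k - 1 - h}.
          replicate_mset ((k - 2 - h) choose (i - 1)) (k - i, h))
      + (if \<pi> \<noteq> id_perm n \<and> m \<ge> 1
         then \<Sum>i\<in>{0..k - m}. replicate_mset ((k - m) choose i) (k - i, m - 1)
         else {#}) \<and>
    (m = 0 \<longrightarrow> branches T = {#})"
proof (cases "m = 0")
  case True
  then have "children n \<pi> = {}"
    using children_empty assms(1,2) by blast
  then show ?thesis
    using True assms(2,3)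
    by (simp add: root_skeleton branches_skeleton child_labels_skeleton)
next
  case False
  then have "child_labels T = gap_labels k m + (if \<pi> \<noteq> id_perm n
      then \<Sum>i\<le>k - m. replicate_mset ((k - m) choose i) (k - i, m - 1) else {#})"
    using assms(3) child_labels_skeleton image_label_children[OF assms(1,2)] by simp
  then show ?thesis
    using False assms(2,3) by (simp add: gap_labels_def atMost_atLeast0 root_skeleton)
qed

end
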